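(* Let $(S,\mathcal{I})$ be an independence system, given as a combination of independence systems $(S_j,\mathcal{I}_j)$, $j\in[M]$ (possibly with a single component, $M=1$), and let $w:S\to\mathbb{R}_{\ge 0}$ be injective. Let $p\in[0,1]$ and run the Free-Order General Secretary algorithm (described in the context) with parameter $p$. Then it returns an independent set $\mathrm{ALG}\in\mathcal{I}$ such that, for every element $f\in S$ (for which the conditioning event has positive probability), $$\Pr\left[f\in \mathrm{ALG}\;\middle|\; f\in \mathrm{Core}(\mathrm{Rel}(Y))\right]\ \ge\ \frac14,$$ where $Y$ is the random set sampled by the algorithm.
   Context: An independence system $(S,\mathcal{I})$ is a finite set $S$ with a nonempty downward-closed family $\mathcal{I}\subseteq 2^S$ of independent sets; circuits are the inclusion-wise minimal non-independent sets. Write $X+e=X\cup\{e\}$, $X-e=X\setminus\{e\}$. Combination: the combination of independence systems $(S_j,\mathcal{I}_j)$, $j\in[M]$, is $(S,\mathcal{I})$ with $S=\bigcup_j S_j$ and $\mathcal{I}=\{I\subseteq S: I\cap S_j\in\mathcal{I}_j\ \forall j\in[M]\}$. Primitive hull of component $j$: for $X\subseteq S_j$, $\mathrm{PHull}_j(X)=X\cup\{e\in S_j: e \text{ belongs to some circuit of } (S_j,\mathcal{I}_j) \text{ contained in } X+e\}$. Hull: $\mathrm{Hull}(X)=\bigcup_{j=1}^M \mathrm{PHull}_j(X\cap S_j)$ for $X\subseteq S$. Primitive core of component $j$: for $X\subseteq S_j$, $\mathrm{PCore}_j(X)=\{e\in X: e\notin \mathrm{PHull}_j(\{f\in X: w(f)>w(e)\})\}$.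 Core: $\mathrm{Core}(X)=\bigcap_{j=1}^M\big((X\setminus S_j)\cup \mathrm{PCore}_j(X\cap S_j)\big)$ for $X\subseteq S$. $\mathrm{Greedy}(X)$: process the elements of $X$ in decreasing order of $w$, starting from $\emptyset$, adding an element whenever the current set stays in $\mathcal{I}$; $\mathrm{Greedy}(X)$ is the final set. For $Y\subseteq S$, the set of greedy-relevant elements is $\mathrm{Rel}(Y)=\{y\in S\setminus Y: y\in \mathrm{Greedy}(Y+y)\}$. Free-Order General Secretary algorithm with parameter $p$ (the system is known, the weights are revealed only when an element is observed; the algorithm chooses the order of observation): 1. Set $\mathrm{ALG}=\emptyset$. For each $e\in S$ choose $t_e$ independently and uniformly from $(0,1)$. Let $Y=\{e: t_e\in(0,p)\}$, $S_1=\{e: t_e\in[p,(1+p)/2)\}$, $S_2=\{e: t_e\in[(1+p)/2,1)\}$. 2. Observe, without accepting, all elements of $Y\cup S_1$. Let $U=S_2$ (unseen elements). Sort the elements of $\mathrm{Rel}(Y)\cap S_1$ in decreasing order of weight as $e_1,\dots,e_m$. 3. For $j=1,\dots,m$: let $Q=U\cap\mathrm{Hull}(\{e_1,\dots,e_j\})$; for each $f\in Q$ in arbitrary order, remove $f$ from $U$ and reveal it; if $f\in\mathrm{Rel}(Y)$, $w(f)>w(e_j)$ and $\mathrm{ALG}+f\in\mathcal{I}$, add $f$ to $\mathrm{ALG}$. 4. For each remaining $f\in U$ in arbitrary order: if $f\in\mathrm{Rel}(Y)$ and $\mathrm{ALG}+f\in\mathcal{I}$, add $f$ to $\mathrm{ALG}$.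 5. Return $\mathrm{ALG}$. *)

theory Defs
  imports "HOL-Probability.Probability"
begin

text \<open>A combination of \<open>N\<close> components is given by the ground sets \<open>G j\<close> and the
  families \<open>F j\<close> of independent sets for \<open>j \<in> {1..N}\<close>.\<close>

definition independence_system :: "'a set \<Rightarrow> 'a set set \<Rightarrow> bool" where
  "independence_system S I \<longleftrightarrow>
     finite S \<and> I \<subseteq> Pow S \<and> I \<noteq> {} \<and> (\<forall>X\<in>I. \<forall>Y. Y \<subseteq> X \<longrightarrow> Y \<in> I)"

definition circuit :: "'a set \<Rightarrow> 'a set set \<Rightarrow> 'a set \<Rightarrow> bool" where
  "circuit S I C \<longleftrightarrow> C \<subseteq> S \<and> C \<notin> I \<and> (\<forall>D. D \<subset> C \<longrightarrow> D \<in> I)"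

definition comb_ground :: "nat \<Rightarrow> (nat \<Rightarrow> 'a set) \<Rightarrow> 'a set" where
  "comb_ground N G = (\<Union>j\<in>{1..N}. G j)"

definition comb_indep :: "nat \<Rightarrow> (nat \<Rightarrow> 'a set) \<Rightarrow> (nat \<Rightarrow> 'a set set) \<Rightarrow> 'a set set" where
  "comb_indep N G F = {X. X \<subseteq> comb_ground N G \<and> (\<forall>j\<in>{1..N}. X \<inter> G j \<in> F j)}"

definition PHull :: "'a set \<Rightarrow> 'a set set \<Rightarrow> 'a set \<Rightarrow> 'a set" where
  "PHull S I X = X \<union> {e \<in> S. \<exists>C. circuit S I C \<and> e \<in> C \<and> C \<subseteq> insert e X}"

definition Hull :: "nat \<Rightarrow> (nat \<Rightarrow> 'a set) \<Rightarrow> (nat \<Rightarrow> 'a set set) \<Rightarrow> 'a set \<Rightarrow> 'a set" where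
  "Hull N G F X = (\<Union>j\<in>{1..N}. PHull (G j) (F j) (X \<inter> G j))"

definition PCore :: "'a set \<Rightarrow> 'a set set \<Rightarrow> ('a \<Rightarrow> real) \<Rightarrow> 'a set \<Rightarrow> 'a set" where
  "PCore S I w X = {e \<in> X. e \<notin> PHull S I {f \<in> X. w f > w e}}"

text \<open>The intersection defining \<open>Core\<close> is meant for \<open>N \<ge> 1\<close>; for \<open>N = 0\<close> it would be \<open>UNIV\<close>.\<close>

definition Core ::
  "nat \<Rightarrow> (nat \<Rightarrow> 'a set) \<Rightarrow> (nat \<Rightarrow> 'a set set) \<Rightarrow> ('a \<Rightarrow> real) \<Rightarrow> 'a set \<Rightarrow> 'a set" where
  "Core N G F w X = (\<Inter>j\<in>{1..N}. (X - G j) \<union> PCore (G j) (F j) w (X \<inter> G j))"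

text \<open>The list is in decreasing order of weight, and contains exactly the elements of \<open>X\<close>, only
  if \<open>X\<close> is finite and \<open>w\<close> is injective on \<open>X\<close>.\<close>

definition decreasing :: "('a \<Rightarrow> real) \<Rightarrow> 'a set \<Rightarrow> 'a list" where
  "decreasing w X = sorted_key_list_of_set (\<lambda>e. - w e) X"

definition Greedy :: "'a set set \<Rightarrow> ('a \<Rightarrow> real) \<Rightarrow> 'a set \<Rightarrow> 'a set" where
  "Greedy I w X = foldl (\<lambda>A e. if insert e A \<in> I then insert e A else A) {} (decreasing w X)"

definition Rel :: "'a set \<Rightarrow> 'a set set \<Rightarrow> ('a \<Rightarrow> real) \<Rightarrow> 'a set \<Rightarrow> 'a set" where
  "Rel S I w Y = {y \<in> S - Y. y \<in> Greedy I w (insert y Y)}"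

definition sampleY :: "'a set \<Rightarrow> real \<Rightarrow> ('a \<Rightarrow> real) \<Rightarrow> 'a set" where
  "sampleY S p \<tau> = {e \<in> S. \<tau> e \<in> {0<..<p}}"

definition sample1 :: "'a set \<Rightarrow> real \<Rightarrow> ('a \<Rightarrow> real) \<Rightarrow> 'a set" where
  "sample1 S p \<tau> = {e \<in> S. \<tau> e \<in> {p..<(1 + p) / 2}}"

definition sample2 :: "'a set \<Rightarrow> real \<Rightarrow> ('a \<Rightarrow> real) \<Rightarrow> 'a set" where
  "sample2 S p \<tau> = {e \<in> S. \<tau> e \<in> {(1 + p) / 2..<1}}"

text \<open>Process the elements of \<open>fs\<close> in this order, adding to \<open>A\<close> every candidate (element of \<open>K\<close>)
  that keeps it independent.\<close>

definition select :: "'a set set \<Rightarrow> 'a set \<Rightarrow> 'a set \<Rightarrow> 'a list \<Rightarrow> 'a set" where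
  "select I K A fs = foldl (\<lambda>A f. if f \<in> K \<and> insert f A \<in> I then insert f A else A) A fs"

text \<open>The main loop, nondeterministic because the list \<open>fs\<close> is an arbitrary enumeration of the set
  of elements revealed in the current round. \<open>main_loop N G F w R es es' U A U' A'\<close> holds if, with
  \<open>R\<close> the set of relevant elements, \<open>es\<close> the pivots already treated, \<open>es'\<close> those still to come,
  \<open>U\<close> the unseen and \<open>A\<close> the accepted elements, the loop can end with \<open>U'\<close> unseen and \<open>A'\<close>
  accepted.\<close>

inductive main_loop ::
  "nat \<Rightarrow> (nat \<Rightarrow> 'a set) \<Rightarrow> (nat \<Rightarrow> 'a set set) \<Rightarrow> ('a \<Rightarrow> real) \<Rightarrow> 'a set \<Rightarrow>
     'a list \<Rightarrow> 'a list \<Rightarrow> 'a set \<Rightarrow> 'a set \<Rightarrow> 'a set \<Rightarrow> 'a set \<Rightarrow> bool"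
  for N G F w R where
  main_loop_Nil: "main_loop N G F w R es [] U A U A"
| main_loop_Cons:
    "\<lbrakk>distinct fs; set fs = U \<inter> Hull N G F (set (es @ [e]));
      main_loop N G F w R (es @ [e]) es' (U - set fs)
        (select (comb_indep N G F) {f \<in> R. w f > w e} A fs) U' A'\<rbrakk>
     \<Longrightarrow> main_loop N G F w R es (e # es') U A U' A'"

text \<open>\<open>general_secretary N G F w p \<tau> A\<close>: when the elements have times \<open>\<tau>\<close>, the algorithm returns
  \<open>A\<close> for some choice of the orders left open.\<close>

definition general_secretary ::
  "nat \<Rightarrow> (nat \<Rightarrow> 'a set) \<Rightarrow> (nat \<Rightarrow> 'a set set) \<Rightarrow> ('a \<Rightarrow> real) \<Rightarrow> real \<Rightarrow>
     ('a \<Rightarrow> real) \<Rightarrow> 'a set \<Rightarrow> bool" where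
  "general_secretary N G F w p \<tau> A \<longleftrightarrow>
     (let S = comb_ground N G; I = comb_indep N G F; R = Rel S I w (sampleY S p \<tau>)
      in \<exists>U A\<^sub>0 fs.
           main_loop N G F w R [] (decreasing w (R \<inter> sample1 S p \<tau>)) (sample2 S p \<tau>) {} U A\<^sub>0 \<and>
           distinct fs \<and> set fs = U \<and> A = select I R A\<^sub>0 fs)"

lemma main_loop_total:
  "finite U \<Longrightarrow> \<exists>U' A'. finite U' \<and> main_loop N G F w R es es' U A U' A'"
proof (induction es' arbitrary: es U A)
  case Nil
  then show ?case using main_loop_Nil[of N G F w R es U A] by (intro exI conjI)
next
  case (Cons e es')
  obtain fs where fs: "distinct fs" "set fs = U \<inter> Hull N G F (set (es @ [e]))"
    using Cons.prems finite_distinct_list[of "U \<inter> Hull N G F (set (es @ [e]))"] by auto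
  obtain U' A' where "finite U'" and
    "main_loop N G F w R (es @ [e]) es' (U - set fs)
       (select (comb_indep N G F) {f \<in> R. w f > w e} A fs) U' A'"
    using Cons.IH[of "U - set fs" "es @ [e]"
      "select (comb_indep N G F) {f \<in> R. w f > w e} A fs"] Cons.prems by auto
  then show ?case
    by (intro exI conjI main_loop_Cons[OF fs])
qed

text \<open>The algorithm never gets stuck.\<close>

lemma general_secretary_total:
  assumes "finite (comb_ground N G)"
  shows "\<exists>A. general_secretary N G F w p \<tau> A"
proof -
  let ?S = "comb_ground N G" and ?I = "comb_indep N G F"
  let ?R = "Rel ?S ?I w (sampleY ?S p \<tau>)"
  have "finite (sample2 ?S p \<tau>)"
    using assms by (simp add: sample2_def)
  from main_loop_total[OF this, of N G F w ?R "[]" "decreasing w (?R \<inter> sample1 ?S p \<tau>)" "{}"]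
  obtain U A where "finite U" and
    run: "main_loop N G F w ?R [] (decreasing w (?R \<inter> sample1 ?S p \<tau>)) (sample2 ?S p \<tau>) {} U A"
    by auto
  from finite_distinct_list[OF \<open>finite U\<close>] obtain fs where "set fs = U" "distinct fs"
    by auto
  then show ?thesis
    unfolding general_secretary_def Let_def using run by fast
qed

end

theory Submission
  imports Defs
begin

text \<open>Fix \<open>f\<close>, condition on \<open>Y\<close> and on \<open>f \<in> Core (Rel Y)\<close>, and let \<open>A\<close> and \<open>B\<close> be the elements of
  \<open>Rel Y - {f}\<close> in the two halves \<open>S\<^sub>1\<close> and \<open>S\<^sub>2\<close> of the remaining elements. The weights \<open>x\<close> such
  that the elements of \<open>A\<close> heavier than \<open>x\<close> have \<open>f\<close> in their hull form a down-closed set of reals,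
  and so do those for \<open>B\<close>. Of two such sets one contains the other, and by symmetry between the
  halves the set for \<open>A\<close> contains the set for \<open>B\<close> with probability at least \<open>1/2\<close>. If moreover
  \<open>f \<in> S\<^sub>2\<close>, which is independent of this and has probability \<open>1/2\<close>, then \<open>f\<close> is accepted. Indeed,
  \<open>f\<close> is revealed at a pivot \<open>e\<close> lighter than \<open>f\<close>, because \<open>f\<close> is in the core, and all elements
  accepted so far are heavier than \<open>e\<close>. If they blocked \<open>f\<close>, then \<open>f\<close> would be in the hull of the
  elements of \<open>B\<close> heavier than \<open>e\<close>, hence of the pivots before \<open>e\<close>, and would have been revealed
  earlier.\<close>

section \<open>Hulls, cores and circuits\<close>

lemma PHull_mono: "X \<subseteq> Y \<Longrightarrow> PHull S I X \<subseteq> PHull S I Y"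
  unfolding PHull_def by blast

lemma Hull_mono: "X \<subseteq> Y \<Longrightarrow> Hull N G F X \<subseteq> Hull N G F Y"
  unfolding Hull_def by (intro UN_mono PHull_mono) auto

lemma PHull_subset: "X \<subseteq> S \<Longrightarrow> PHull S I X \<subseteq> S"
  unfolding PHull_def by blast

lemma Core_subset: "N \<ge> 1 \<Longrightarrow> Core N G F w X \<subseteq> X"
  unfolding Core_def PCore_def by force

text \<open>A primitive hull never leaves its component, so the component that puts \<open>f\<close>
  into the hull contains \<open>f\<close>. There the core condition on \<open>f\<close> is the one
  in \<open>PCore\<close>, which rules this out.\<close>

lemma Core_not_in_Hull_heavier:
  assumes "f \<in> Core N G F w X"
  shows "f \<notin> Hull N G F {g \<in> X. w g > w f}"
proof
  assume "f \<in> Hull N G F {g \<in> X. w g > w f}"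
  then obtain j where j: "j \<in> {1..N}" and h: "f \<in> PHull (G j) (F j) ({g \<in> X. w g > w f} \<inter> G j)"
    unfolding Hull_def by blast
  have "f \<in> G j"
    using h PHull_subset[of "{g \<in> X. w g > w f} \<inter> G j" "G j" "F j"] by blast
  then have "f \<notin> PHull (G j) (F j) {g \<in> X \<inter> G j. w g > w f}"
    using assms j unfolding Core_def PCore_def by blast
  moreover have "{g \<in> X. w g > w f} \<inter> G j = {g \<in> X \<inter> G j. w g > w f}"
    by blast
  ultimately show False
    using h by simp
qed

lemma ex_circuit:
  assumes "finite X" "X \<subseteq> S" "X \<notin> I"
  shows "\<exists>C\<subseteq>X. circuit S I C"
  using assms
proof (induction X rule: finite_psubset_induct)
  case (psubset X)
  then show ?case
    unfolding circuit_def by (metis order_trans psubset_imp_subset order_refl)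
qed

text \<open>As \<open>A\<close> is independent, a circuit in a violated component must contain
  \<open>f\<close>. The form \<open>A - {f}\<close> fits the later sets, all of which omit
  \<open>f\<close>.\<close>

lemma dependent_imp_mem_Hull:
  assumes sys: "\<And>j. j \<in> {1..N} \<Longrightarrow> independence_system (G j) (F j)"
    and A: "A \<in> comb_indep N G F" and f: "f \<in> comb_ground N G"
    and dep: "insert f A \<notin> comb_indep N G F"
  shows "f \<in> Hull N G F (A - {f})"
proof -
  have "insert f A \<subseteq> comb_ground N G"
    using A f unfolding comb_indep_def by blast
  then obtain j where j: "j \<in> {1..N}" and nin: "insert f A \<inter> G j \<notin> F j"
    using dep unfolding comb_indep_def by blast
  note sysj = sys[OF j, unfolded independence_system_def]
  obtain C where C: "C \<subseteq> insert f A \<inter> G j" "circuit (G j) (F j) C"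
    using ex_circuit[of "insert f A \<inter> G j" "G j" "F j"] sysj nin by auto
  have "f \<in> C"
  proof (rule ccontr)
    assume "f \<notin> C"
    then have "C \<subseteq> A \<inter> G j"
      using C by blast
    moreover have "A \<inter> G j \<in> F j"
      using A j unfolding comb_indep_def by blast
    ultimately have "C \<in> F j"
      using sysj by blast
    then show False
      using C(2) unfolding circuit_def by blast
  qed
  moreover have "C \<subseteq> insert f ((A - {f}) \<inter> G j)"
    using C(1) by blast
  ultimately have "f \<in> PHull (G j) (F j) ((A - {f}) \<inter> G j)"
    using C unfolding PHull_def by blast
  then show ?thesis
    using j unfolding Hull_def by blast
qed

lemma empty_mem_comb_indep:
  assumes "\<And>j. j \<in> {1..N} \<Longrightarrow> independence_system (G j) (F j)"
  shows "{} \<in> comb_indep N G F"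
  using assms unfolding comb_indep_def independence_system_def by fastforce

section \<open>Selection rounds and the main loop\<close>

lemma select_Nil [simp]: "select I K A [] = A"
  by (simp add: select_def)

lemma select_Cons [simp]:
  "select I K A (f # fs) = select I K (if f \<in> K \<and> insert f A \<in> I then insert f A else A) fs"
  by (simp add: select_def)

lemma select_indep: "A \<in> I \<Longrightarrow> select I K A fs \<in> I"
  by (induction fs arbitrary: A) auto

lemma select_mono: "A \<subseteq> select I K A fs"
  by (induction fs arbitrary: A) (auto, blast)

lemma select_subset: "select I K A fs \<subseteq> A \<union> (K \<inter> set fs)"
proof (induction fs arbitrary: A)
  case (Cons g fs)
  show ?case
    using Cons.IH[of "if g \<in> K \<and> insert g A \<in> I then insert g A else A"] by (auto split: if_splits)
qed simp

text \<open>The order of \<open>fs\<close> is arbitrary, so the set held when \<open>f\<close> has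
  its turn is unknown; the last premise covers every independent set that it could be.\<close>

lemma mem_select:
  assumes "A \<in> I" "f \<in> K" "f \<in> set fs"
    and "\<And>B. \<lbrakk>B \<in> I; B \<subseteq> A \<union> (K \<inter> set fs)\<rbrakk> \<Longrightarrow> insert f B \<in> I"
  shows "f \<in> select I K A fs"
  using assms
proof (induction fs arbitrary: A)
  case (Cons g fs)
  let ?A = "if g \<in> K \<and> insert g A \<in> I then insert g A else A"
  show ?case
  proof (cases "g = f")
    case True
    have "insert f A \<in> I"
      using Cons.prems by blast
    then show ?thesis
      using True Cons.prems(2) select_mono[of "insert f A" I K fs] by auto
  next
    case False
    have "f \<in> select I K ?A fs"
    proof (rule Cons.IH)
      fix B assume "B \<in> I" "B \<subseteq> ?A \<union> (K \<inter> set fs)"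
      then show "insert f B \<in> I"
        by (intro Cons.prems(4)) (auto split: if_splits)
    qed (use Cons.prems False in auto)
    then show ?thesis
      by simp
  qed
qed simp

lemma main_loop_indep:
  assumes "main_loop N G F w R es es' U A U' A'" "A \<in> comb_indep N G F"
  shows "A' \<in> comb_indep N G F"
  using assms by (induction rule: main_loop.induct) (auto intro: select_indep)

lemma main_loop_mono:
  assumes "main_loop N G F w R es es' U A U' A'"
  shows "A \<subseteq> A'"
  using assms
proof (induction rule: main_loop.induct)
  case (main_loop_Cons fs U es e es' A U' A')
  then show ?case
    using select_mono by fastforce
qed simp

text \<open>The loop invariant, with \<open>V\<close> in the role of the second half: accepted
  elements are heavier than all pending pivots, and the hull of the treated pivots omits
  \<open>f\<close>. The premise \<open>good\<close> mentions only \<open>es @ es'\<close>, which no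
  round changes. In the second alternative \<open>f\<close> is left to the final pass.\<close>

lemma main_loop_mem_or_unseen:
  assumes "main_loop N G F w R es es' U A U' A'"
    and sys: "\<And>j. j \<in> {1..N} \<Longrightarrow> independence_system (G j) (F j)"
    and f: "f \<in> comb_ground N G" "f \<in> R" and core: "f \<in> Core N G F w R"
    and inj: "inj_on w R"
    and good: "\<And>x. f \<in> Hull N G F {g \<in> R \<inter> V - {f}. w g > x} \<Longrightarrow>
                     f \<in> Hull N G F {g \<in> set (es @ es'). w g > x}"
    and es: "sorted_wrt (\<lambda>x y. w x > w y) (es @ es')" "set (es @ es') \<subseteq> R - {f}"
    and A: "A \<in> comb_indep N G F" "A \<subseteq> R \<inter> V - {f}" "\<And>g e. g \<in> A \<Longrightarrow> e \<in> set es' \<Longrightarrow> w g > w e"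
    and U: "U \<subseteq> V" "f \<in> U" "f \<notin> Hull N G F (set es)"
  shows "f \<in> A' \<or>
    f \<in> U' \<and> f \<notin> Hull N G F (set (es @ es')) \<and> U' \<subseteq> V \<and> A' \<subseteq> R \<inter> V - {f}"
  using assms(1) good es A U
proof (induction rule: main_loop.induct)
  case (main_loop_Nil es U A)
  then show ?case
    by simp
next
  case (main_loop_Cons fs U es e es' A U' A')
  let ?I = "comb_indep N G F" and ?K = "{f \<in> R. w f > w e}"
  \<comment> \<open>At the threshold \<open>w e\<close> the premise \<open>good\<close> speaks only
    of pivots before \<open>e\<close>, whose hull does not contain \<open>f\<close> yet.\<close>
  have before: "{g \<in> set (es @ e # es'). w g > w e} \<subseteq> set es"
    using main_loop_Cons.prems(2) by (auto simp: sorted_wrt_append)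
  show ?case
  proof (cases "f \<in> set fs")
    case True
    \<comment> \<open>A pivot differs from \<open>f\<close>, so by injectivity \<open>e\<close>
      would be heavier than \<open>f\<close>, and so would all earlier pivots; their hull contains
      \<open>f\<close>, against the core.\<close>
    have "w f > w e"
    proof (rule ccontr)
      assume "\<not> w f > w e"
      then have "set (es @ [e]) \<subseteq> {g \<in> R. w g > w f}"
        using main_loop_Cons.prems(2,3) inj f(2) by (force simp: sorted_wrt_append inj_on_def)
      from Hull_mono[OF this, of N G F] show False
        using Core_not_in_Hull_heavier[OF core] main_loop_Cons.hyps(2) True by blast
    qed
    have "f \<in> select ?I ?K A fs"
    proof (rule mem_select)
      fix B assume B: "B \<in> ?I" "B \<subseteq> A \<union> (?K \<inter> set fs)"
      show "insert f B \<in> ?I"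
      proof (rule ccontr)
        assume "insert f B \<notin> ?I"
        with B(1) have "f \<in> Hull N G F (B - {f})"
          by (intro dependent_imp_mem_Hull sys f)
        \<comment> \<open>Earlier acceptances are heavier than the pivot \<open>e\<close> by the
          invariant, the candidates of this round by the choice of \<open>?K\<close>.\<close>
        moreover have "B - {f} \<subseteq> {g \<in> R \<inter> V - {f}. w g > w e}"
          using B(2) main_loop_Cons.prems(5-7) main_loop_Cons.hyps(2) by auto
        ultimately have "f \<in> Hull N G F {g \<in> R \<inter> V - {f}. w g > w e}"
          by (rule subsetD[OF Hull_mono, rotated])
        from main_loop_Cons.prems(1)[OF this] show False
          using Hull_mono[OF before, of N G F] main_loop_Cons.prems(9) by blast
      qed
    qed (use main_loop_Cons.prems True f \<open>w f > w e\<close> in auto)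
    then show ?thesis
      using main_loop_mono[OF main_loop_Cons.hyps(3)] by blast
  next
    case False
    have sel: "select ?I ?K A fs \<subseteq> A \<union> (?K \<inter> set fs)"
      by (rule select_subset)
    have "f \<in> A' \<or> f \<in> U' \<and> f \<notin> Hull N G F (set ((es @ [e]) @ es')) \<and> U' \<subseteq> V \<and> A' \<subseteq> R \<inter> V - {f}"
    proof (rule main_loop_Cons.IH)
      show "select ?I ?K A fs \<subseteq> R \<inter> V - {f}"
        using sel main_loop_Cons.prems(5,7) main_loop_Cons.hyps(2) False by blast
      fix g e' assume g: "g \<in> select ?I ?K A fs" "e' \<in> set es'"
      have "w e > w e'"
        using main_loop_Cons.prems(2) g(2) by (auto simp: sorted_wrt_append)
      then show "w g > w e'"
        using sel g main_loop_Cons.prems(6) by fastforce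
    qed (use main_loop_Cons.prems main_loop_Cons.hyps False in \<open>auto intro: select_indep\<close>)
    then show ?thesis
      by simp
  qed
qed

lemma (in linorder) strict_sorted_key_list_of_set_inj:
  assumes "finite X" "inj_on h X"
  shows "set (sorted_key_list_of_set h X) = X" "sorted_wrt (<) (map h (sorted_key_list_of_set h X))"
proof -
  interpret folding_insort_key "(\<le>)" "(<)" X h
    by standard fact
  show "set (sorted_key_list_of_set h X) = X"
    using assms(1) by simp
  show "sorted_wrt (<) (map h (sorted_key_list_of_set h X))"
    by simp
qed

lemma decreasing:
  assumes "finite X" "inj_on w X"
  shows "set (decreasing w X) = X" "sorted_wrt (\<lambda>x y. w x > w y) (decreasing w X)"
proof -
  have "inj_on (\<lambda>e. - w e) X"
    using assms(2) by (simp add: inj_on_def)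
  note * = strict_sorted_key_list_of_set_inj[OF assms(1) this, folded decreasing_def]
  show "set (decreasing w X) = X"
    by (rule *)
  show "sorted_wrt (\<lambda>x y. w x > w y) (decreasing w X)"
    using *(2) by (simp add: sorted_wrt_map)
qed

section \<open>Runs of the algorithm for fixed times\<close>

lemma general_secretary_indep:
  assumes "\<And>j. j \<in> {1..N} \<Longrightarrow> independence_system (G j) (F j)"
    and "general_secretary N G F w p \<tau> A"
  shows "A \<in> comb_indep N G F"
  using assms unfolding general_secretary_def Let_def
  by (auto intro!: select_indep main_loop_indep[OF _ empty_mem_comb_indep])

lemma general_secretary_accepts:
  fixes \<tau> :: "'a \<Rightarrow> real"
  assumes sys: "\<And>j. j \<in> {1..N} \<Longrightarrow> independence_system (G j) (F j)"
    and "N \<ge> 1" and inj: "inj_on w (comb_ground N G)"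
    and nonneg: "\<And>e. e \<in> comb_ground N G \<Longrightarrow> w e \<ge> 0"
    and R: "R = Rel (comb_ground N G) (comb_indep N G F) w (sampleY (comb_ground N G) p \<tau>)"
    and S1: "S\<^sub>1 = sample1 (comb_ground N G) p \<tau>" and S2: "S\<^sub>2 = sample2 (comb_ground N G) p \<tau>"
    and f: "f \<in> S\<^sub>2" "f \<in> Core N G F w R"
    and good: "\<And>x. f \<in> Hull N G F {g \<in> R \<inter> S\<^sub>2 - {f}. w g > x} \<Longrightarrow>
                     f \<in> Hull N G F {g \<in> R \<inter> S\<^sub>1 - {f}. w g > x}"
    and run: "general_secretary N G F w p \<tau> A"
  shows "f \<in> A"
proof -
  let ?S = "comb_ground N G" and ?I = "comb_indep N G F"
  obtain U A\<^sub>0 fs where loop: "main_loop N G F w R [] (decreasing w (R \<inter> S\<^sub>1)) S\<^sub>2 {} U A\<^sub>0"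
    and fs: "set fs = U" and A: "A = select ?I R A\<^sub>0 fs"
    using run unfolding general_secretary_def Let_def R[symmetric] S1[symmetric] S2[symmetric]
    by blast
  have "f \<in> R"
    by (rule subsetD[OF Core_subset[OF \<open>N \<ge> 1\<close>] f(2)])
  have "R \<subseteq> ?S"
    unfolding R Rel_def by blast
  then have "f \<in> ?S" "inj_on w R"
    using \<open>f \<in> R\<close> inj_on_subset[OF inj] by auto
  have "finite ?S"
    using sys unfolding comb_ground_def independence_system_def by auto
  then have "finite (R \<inter> S\<^sub>1)"
    using \<open>R \<subseteq> ?S\<close> by (meson finite_Int finite_subset)
  note dec = decreasing[OF this inj_on_subset[OF \<open>inj_on w R\<close> Int_lower1]]
  have "S\<^sub>1 \<inter> S\<^sub>2 = {}"
    unfolding S1 S2 sample1_def sample2_def by auto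
  then have "f \<notin> S\<^sub>1"
    using f(1) by blast
  \<comment> \<open>The invariant must hold before any pivot is treated; the core gives this by
    monotonicity of the hull.\<close>
  have "f \<notin> Hull N G F {}"
    using Core_not_in_Hull_heavier[OF f(2)] Hull_mono[of "{}" "{g \<in> R. w g > w f}" N G F] by blast
  then have loop_cases:
    "f \<in> A\<^sub>0 \<or> f \<in> U \<and> f \<notin> Hull N G F (set ([] @ decreasing w (R \<inter> S\<^sub>1))) \<and> U \<subseteq> S\<^sub>2 \<and>
       A\<^sub>0 \<subseteq> R \<inter> S\<^sub>2 - {f}"
    using \<open>f \<in> ?S\<close> \<open>f \<in> R\<close> \<open>f \<notin> S\<^sub>1\<close> dec f good empty_mem_comb_indep[OF sys] \<open>inj_on w R\<close>
    by (intro main_loop_mem_or_unseen[OF loop sys]) auto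
  show ?thesis
  proof (cases "f \<in> A\<^sub>0")
    case True
    then show ?thesis
      unfolding A by (rule subsetD[OF select_mono])
  next
    case False
    then have unseen: "f \<in> U" "f \<notin> Hull N G F (R \<inter> S\<^sub>1)" "U \<subseteq> S\<^sub>2" "A\<^sub>0 \<subseteq> R \<inter> S\<^sub>2 - {f}"
      using loop_cases dec by auto
    show ?thesis
      unfolding A
    proof (rule mem_select)
      show "A\<^sub>0 \<in> ?I"
        by (rule main_loop_indep[OF loop empty_mem_comb_indep[OF sys]])
      fix B assume B: "B \<in> ?I" "B \<subseteq> A\<^sub>0 \<union> (R \<inter> set fs)"
      show "insert f B \<in> ?I"
      proof (rule ccontr)
        assume "insert f B \<notin> ?I"
        with B(1) have "f \<in> Hull N G F (B - {f})"
          by (intro dependent_imp_mem_Hull sys \<open>f \<in> ?S\<close>)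
        \<comment> \<open>The threshold \<open>-1\<close> lies below all weights. As the comparison
          is strict, \<open>0\<close> would lose an element of weight \<open>0\<close>.\<close>
        moreover have "B - {f} \<subseteq> {g \<in> R \<inter> S\<^sub>2 - {f}. w g > -1}"
        proof
          fix g assume g: "g \<in> B - {f}"
          then have "g \<in> R \<inter> S\<^sub>2 - {f}"
            using B(2) unseen(3,4) fs by blast
          moreover from this have "w g \<ge> 0"
            using nonneg \<open>R \<subseteq> ?S\<close> by blast
          ultimately show "g \<in> {g \<in> R \<inter> S\<^sub>2 - {f}. w g > -1}"
            by simp
        qed
        ultimately have "f \<in> Hull N G F {g \<in> R \<inter> S\<^sub>2 - {f}. w g > -1}"
          by (rule subsetD[OF Hull_mono, rotated])
        from good[OF this] show False
          using unseen(2) Hull_mono[of "{g \<in> R \<inter> S\<^sub>1 - {f}. w g > -1}" "R \<inter> S\<^sub>1" N G F] by blast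
      qed
    qed (use unseen \<open>f \<in> R\<close> fs in auto)
  qed
qed

section \<open>Comparison of the halves and sign symmetry of the labels\<close>

lemma Hull_heavier_linear:
  fixes w :: "'a \<Rightarrow> real"
  shows "(\<forall>x. f \<in> Hull N G F {g \<in> B. w g > x} \<longrightarrow> f \<in> Hull N G F {g \<in> A. w g > x}) \<or>
    (\<forall>x. f \<in> Hull N G F {g \<in> A. w g > x} \<longrightarrow> f \<in> Hull N G F {g \<in> B. w g > x})"
proof -
  have "f \<in> Hull N G F {g \<in> X. w g > x} \<Longrightarrow> y \<le> x \<Longrightarrow> f \<in> Hull N G F {g \<in> X. w g > y}" for X x y
    using Hull_mono[of "{g \<in> X. w g > x}" "{g \<in> X. w g > y}" N G F] by fastforce
  then show ?thesis
    by (meson linear)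
qed

text \<open>Independence makes both joint laws products, and equal marginals make these equal.
  Finitely many indices and countably many values make the product space discrete, so that
  \<open>Q\<close> can be arbitrary.\<close>

lemma (in prob_space) indep_vars_same_joint_prob:
  fixes X X' :: "'i \<Rightarrow> 'a \<Rightarrow> 'c :: countable"
  assumes "finite J" "J \<noteq> {}"
    and X: "indep_vars (\<lambda>_. count_space UNIV) X J" and X': "indep_vars (\<lambda>_. count_space UNIV) X' J"
    and same: "\<And>i k. i \<in> J \<Longrightarrow> \<P>(x in M. X i x = k) = \<P>(x in M. X' i x = k)"
  shows "\<P>(x in M. Q (\<lambda>i\<in>J. X i x)) = \<P>(x in M. Q (\<lambda>i\<in>J. X' i x))"
proof -
  let ?N = "PiM J (\<lambda>_. count_space UNIV :: 'c measure)"
  have N: "?N = count_space (PiE J (\<lambda>_. UNIV))"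
    using \<open>finite J\<close> by (intro count_space_PiM_finite) auto
  have rv: "random_variable (count_space UNIV) (X i)" "random_variable (count_space UNIV) (X' i)"
    if "i \<in> J" for i
    using X X' that unfolding indep_vars_def by auto
  have joint: "\<P>(x in M. Q (\<lambda>i\<in>J. Z i x)) = measure (PiM J (\<lambda>i. distr M (count_space UNIV) (Z i)))
      {h \<in> PiE J (\<lambda>_. UNIV). Q h}"
    if Z: "indep_vars (\<lambda>_. count_space UNIV) Z J" for Z :: "'i \<Rightarrow> 'a \<Rightarrow> 'c"
  proof -
    have Zrv: "random_variable (count_space UNIV) (Z i)" if "i \<in> J" for i
      using Z that unfolding indep_vars_def by auto
    then have meas: "(\<lambda>x. \<lambda>i\<in>J. Z i x) \<in> measurable M ?N"
      by (intro measurable_restrict)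
    have "distr M ?N (\<lambda>x. \<lambda>i\<in>J. Z i x) = PiM J (\<lambda>i. distr M (count_space UNIV) (Z i))"
      using indep_vars_iff_distr_eq_PiM'[OF \<open>J \<noteq> {}\<close> Zrv] Z by simp
    then have "measure (PiM J (\<lambda>i. distr M (count_space UNIV) (Z i))) {h \<in> PiE J (\<lambda>_. UNIV). Q h} =
        measure (distr M ?N (\<lambda>x. \<lambda>i\<in>J. Z i x)) {h \<in> PiE J (\<lambda>_. UNIV). Q h}"
      by simp
    also have "\<dots> = measure M ((\<lambda>x. \<lambda>i\<in>J. Z i x) -` {h \<in> PiE J (\<lambda>_. UNIV). Q h} \<inter> space M)"
      by (intro measure_distr meas) (auto simp: N)
    also have "(\<lambda>x. \<lambda>i\<in>J. Z i x) -` {h \<in> PiE J (\<lambda>_. UNIV). Q h} \<inter> space M =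
        {x \<in> space M. Q (\<lambda>i\<in>J. Z i x)}"
      by auto
    finally show ?thesis ..
  qed
  have "distr M (count_space UNIV) (X i) = distr M (count_space UNIV) (X' i)" if "i \<in> J" for i
  proof (rule measure_eqI_countable[of _ UNIV])
    fix k
    have "emeasure (distr M (count_space UNIV) (Z i)) {k} = ennreal \<P>(x in M. Z i x = k)"
      if "random_variable (count_space UNIV) (Z i)" for Z :: "'i \<Rightarrow> 'a \<Rightarrow> 'c"
      using that
      by (subst emeasure_distr) (auto simp: emeasure_eq_measure vimage_def Int_def conj_commute)
    then show "emeasure (distr M (count_space UNIV) (X i)) {k} =
        emeasure (distr M (count_space UNIV) (X' i)) {k}"
      using rv[OF that] same[OF that] by simp
  qed auto
  then have "PiM J (\<lambda>i. distr M (count_space UNIV) (X i)) =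
      PiM J (\<lambda>i. distr M (count_space UNIV) (X' i))"
    by (intro PiM_cong) auto
  then show ?thesis
    by (simp add: joint[OF X] joint[OF X'])
qed

text \<open>The labels \<open>0\<close>, \<open>1\<close> and \<open>-1\<close> stand for \<open>Y\<close>, \<open>S\<^sub>1\<close> and \<open>S\<^sub>2\<close>, so that a change of sign swaps the
  two halves and keeps \<open>Y\<close>; the label \<open>2\<close> has probability \<open>0\<close>.\<close>

definition label :: "real \<Rightarrow> real \<Rightarrow> int" where
  "label p x = (if x \<in> {0<..<p} then 0 else if x \<in> {p..<(1 + p) / 2} then 1
     else if x \<in> {(1 + p) / 2..<1} then -1 else 2)"

lemma label_eq_iff:
  assumes "0 \<le> p" "p \<le> 1"
  shows "label p x = 0 \<longleftrightarrow> x \<in> {0<..<p}" "label p x = 1 \<longleftrightarrow> x \<in> {p..<(1 + p) / 2}"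
    "label p x = -1 \<longleftrightarrow> x \<in> {(1 + p) / 2..<1}" "label p x \<in> {0, 1, -1} \<or> label p x = 2"
    "label p x = 2 \<Longrightarrow> x \<notin> {0<..<1}"
  using assms unfolding label_def by (auto split: if_splits)

lemma measurable_label [measurable]: "label p \<in> measurable borel (count_space UNIV)"
  unfolding label_def by measurable

text \<open>Inside the unit interval the ranges of the labels \<open>1\<close> and \<open>-1\<close>
  both have length \<open>(1 - p) / 2\<close>, \<open>0\<close> is its own negative, and
  \<open>2\<close> occurs only outside.\<close>

lemma (in prob_space) prob_label_minus:
  fixes T :: "'a \<Rightarrow> real"
  assumes "0 \<le> p" "p \<le> 1"
    and T [measurable]: "T \<in> borel_measurable M"
    and unif: "distr M borel T = uniform_measure lborel {0<..<1}"
  shows "\<P>(x in M. - label p (T x) = k) = \<P>(x in M. label p (T x) = k)"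
    and "\<P>(x in M. label p (T x) = 2) = 0"
proof -
  have prob_T: "\<P>(x in M. T x \<in> B) = measure lborel ({0<..<1} \<inter> B)" if [measurable]: "B \<in> sets borel"
    for B :: "real set"
  proof -
    have "\<P>(x in M. T x \<in> B) = measure (distr M borel T) B"
      by (subst measure_distr) (auto simp: vimage_def Int_def conj_commute)
    also have "\<dots> = measure lborel ({0<..<1} \<inter> B)"
      unfolding unif by (subst measure_uniform_measure) auto
    finally show ?thesis .
  qed
  \<comment> \<open>For \<open>p = 0\<close> the range of the label \<open>1\<close> contains
    \<open>0\<close>, which the open unit interval omits.\<close>
  have "{0<..<1} \<inter> {p..<(1 + p) / 2} = (if p = 0 then {0<..<1 / 2} else {p..<(1 + p) / 2})"
    "{0<..<1} \<inter> {(1 + p) / 2..<1} = {(1 + p) / 2..<1}"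
    using assms(1,2) by auto
  moreover have "\<P>(x in M. label p (T x) = 1) = measure lborel ({0<..<1} \<inter> {p..<(1 + p) / 2})"
      "\<P>(x in M. label p (T x) = -1) = measure lborel ({0<..<1} \<inter> {(1 + p) / 2..<1})"
    unfolding label_eq_iff(2,3)[OF assms(1,2)] by (rule prob_T; simp)+
  ultimately have half: "\<P>(x in M. label p (T x) = 1) = (1 - p) / 2"
      "\<P>(x in M. label p (T x) = -1) = (1 - p) / 2"
    using assms(1,2) by (simp_all add: field_simps)
  have "\<P>(x in M. label p (T x) = 2) \<le> \<P>(x in M. T x \<in> - {0<..<1})"
    using label_eq_iff(5)[OF assms(1,2)] by (intro finite_measure_mono) auto
  also have "\<dots> = 0"
    by (subst prob_T) auto
  finally show junk: "\<P>(x in M. label p (T x) = 2) = 0"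
    by (simp add: measure_le_0_iff)
  show "\<P>(x in M. - label p (T x) = k) = \<P>(x in M. label p (T x) = k)"
  proof -
    have none: "\<P>(x in M. label p (T x) = l) = 0" if "l \<notin> {0, 1, -1}" for l
    proof (cases "l = 2")
      case False
      then have "{x \<in> space M. label p (T x) = l} = {}"
        using label_eq_iff(4)[OF assms(1,2)] that by force
      then show ?thesis
        by (simp only: measure_empty)
    qed (use junk in simp)
    have "{x \<in> space M. - label p (T x) = k} = {x \<in> space M. label p (T x) = - k}"
      by auto
    then show ?thesis
      using half none[of k] none[of "- k"] by (cases "k \<in> {0, 1, -1}") auto
  qed
qed

section \<open>The probability bound by averaging over sign changes\<close>

theorem theorem3:
  fixes N :: nat and G :: "nat \<Rightarrow> 'a set" and F :: "nat \<Rightarrow> 'a set set"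
    and S :: "'a set" and I :: "'a set set"
    and w :: "'a \<Rightarrow> real" and p :: real
    and P :: "'b measure" and t :: "'a \<Rightarrow> 'b \<Rightarrow> real" and ALG :: "'b \<Rightarrow> 'a set"
  assumes "N \<ge> 1"
    and "\<And>j. j \<in> {1..N} \<Longrightarrow> independence_system (G j) (F j)"
    and "S = comb_ground N G" and "I = comb_indep N G F"
    and "\<And>e. e \<in> S \<Longrightarrow> w e \<ge> 0" and "inj_on w S"
    and "0 \<le> p" and "p \<le> 1"
    and "prob_space P"
    and "prob_space.indep_vars P (\<lambda>_. borel) t S"
    and "\<And>e. e \<in> S \<Longrightarrow> distr P borel (t e) = uniform_measure lborel {0<..<1}"
    and "ALG \<in> measurable P (count_space (Pow S))"
    and "\<And>\<omega>. \<omega> \<in> space P \<Longrightarrow> general_secretary N G F w p (\<lambda>e. t e \<omega>) (ALG \<omega>)"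
  shows "(\<forall>\<omega>\<in>space P. ALG \<omega> \<in> I) \<and>
    (\<forall>f\<in>S. \<P>(\<omega> in P. f \<in> Core N G F w (Rel S I w (sampleY S p (\<lambda>e. t e \<omega>)))) > 0 \<longrightarrow>
       \<P>(\<omega> in P. f \<in> ALG \<omega> \<bar> f \<in> Core N G F w (Rel S I w (sampleY S p (\<lambda>e. t e \<omega>)))) \<ge> 1 / 4)"
proof (intro conjI ballI impI)
  fix \<omega> assume "\<omega> \<in> space P"
  then show "ALG \<omega> \<in> I"
    using general_secretary_indep[OF assms(2) assms(13)] assms(4) by blast
next
  interpret prob_space P by fact
  fix f assume "f \<in> S"
  define L where "L e \<omega> = label p (t e \<omega>)" for e \<omega>
  define rel where "rel l = Rel S I w {e \<in> S. l e = 0}" for l :: "'a \<Rightarrow> int"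
  define core where "core l \<longleftrightarrow> f \<in> Core N G F w (rel l)" for l
  \<comment> \<open>The conditions for acceptance of \<open>f\<close> in terms of labels alone, so
    that they can be evaluated after a change of signs.\<close>
  define good where "good l \<longleftrightarrow> core l \<and> l f = -1 \<and>
      (\<forall>x. f \<in> Hull N G F {g \<in> rel l \<inter> {e \<in> S. l e = -1} - {f}. w g > x} \<longrightarrow>
           f \<in> Hull N G F {g \<in> rel l \<inter> {e \<in> S. l e = 1} - {f}. w g > x})" for l
  define lab where "lab s \<omega> = (\<lambda>e\<in>S. s e * L e \<omega>)" for s :: "'a \<Rightarrow> int" and \<omega>
  define C where "C = {\<omega> \<in> space P. core (lab (\<lambda>_. 1) \<omega>)}"
  define E where "E s = {\<omega> \<in> space P. good (lab s \<omega>)}" for s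
  define D where "D = {\<omega> \<in> space P. f \<in> ALG \<omega> \<and> core (lab (\<lambda>_. 1) \<omega>)}"
  assume pos: "\<P>(\<omega> in P. f \<in> Core N G F w (Rel S I w (sampleY S p (\<lambda>e. t e \<omega>)))) > 0"
  note pp = assms(7,8)
  have "finite S"
    using assms(2) unfolding assms(3) comb_ground_def independence_system_def by auto
  have "S \<noteq> {}"
    using \<open>f \<in> S\<close> by auto
  have rvt: "t e \<in> borel_measurable P" if "e \<in> S" for e
    using assms(10) that unfolding indep_vars_def by auto
  have Y: "{e \<in> S. lab (\<lambda>_. 1) \<omega> e = 0} = sampleY S p (\<lambda>e. t e \<omega>)"
    "{e \<in> S. lab (\<lambda>_. 1) \<omega> e = 1} = sample1 S p (\<lambda>e. t e \<omega>)"
    "{e \<in> S. lab (\<lambda>_. 1) \<omega> e = -1} = sample2 S p (\<lambda>e. t e \<omega>)" for \<omega>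
    using label_eq_iff[OF pp] by (auto simp: lab_def L_def sampleY_def sample1_def sample2_def)
  have core_eq: "core (lab (\<lambda>_. 1) \<omega>) \<longleftrightarrow>
      f \<in> Core N G F w (Rel S I w (sampleY S p (\<lambda>e. t e \<omega>)))" for \<omega>
    by (simp add: core_def rel_def Y)

  have indep: "indep_vars (\<lambda>_. count_space UNIV) (\<lambda>e \<omega>. s e * L e \<omega>) S" for s
    unfolding L_def
    using indep_vars_compose2[OF assms(10), of "\<lambda>e x. s e * label p x" "\<lambda>_. count_space UNIV"]
    by simp
  have meas: "lab s \<in> measurable P (count_space (PiE S (\<lambda>_. UNIV)))" for s
  proof -
    have "lab s \<in> measurable P (PiM S (\<lambda>_. count_space UNIV))"
      unfolding lab_def using indep[of s] by (intro measurable_restrict) (simp add: indep_vars_def)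
    then show ?thesis
      using \<open>finite S\<close> by (subst (asm) count_space_PiM_finite) auto
  qed
  have meas_ev: "{\<omega> \<in> space P. Q (lab s \<omega>)} \<in> events" for Q s
    by (rule measurable_compose[OF meas, THEN predE]) auto
  have [measurable]: "C \<in> events" "E s \<in> events" for s
    unfolding C_def E_def by (rule meas_ev)+
  have "{\<omega> \<in> space P. f \<in> ALG \<omega>} \<in> events"
    by (rule measurable_compose[OF assms(12), THEN predE]) auto
  then have [measurable]: "D \<in> events"
    unfolding D_def by (rule sets.sets_Collect_conj[OF meas_ev])

  \<comment> \<open>Each label keeps its law under a change of sign, hence by independence so does
    the whole vector of labels.\<close>
  have prob_E: "prob (E s) = prob (E (\<lambda>_. 1))" if s: "\<And>e. s e \<in> {1, -1}" for s
    unfolding E_def lab_def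
  proof (rule indep_vars_same_joint_prob[OF \<open>finite S\<close> \<open>S \<noteq> {}\<close> indep indep])
    fix e k assume "e \<in> S"
    then show "\<P>(\<omega> in P. s e * L e \<omega> = k) = \<P>(\<omega> in P. 1 * L e \<omega> = k)"
      using prob_label_minus(1)[OF pp rvt assms(11)] s[of e] by (auto simp: L_def)
  qed

  have E_sub: "E (\<lambda>_. 1) \<subseteq> D"
  proof
    fix \<omega> assume \<omega>: "\<omega> \<in> E (\<lambda>_. 1)"
    then have "\<omega> \<in> space P" and good: "good (lab (\<lambda>_. 1) \<omega>)"
      by (auto simp: E_def)
    have "f \<in> ALG \<omega>"
      using good unfolding good_def rel_def core_def Y
      by (intro general_secretary_accepts[OF assms(2,1) assms(6)[unfolded assms(3)] assms(5)[unfolded assms(3)]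
            refl refl refl _ _ _ assms(13)[OF \<open>\<omega> \<in> space P\<close>]])
        (use \<open>f \<in> S\<close> Y(3)[of \<omega>] in \<open>auto simp: assms(3,4)\<close>)
    then show "\<omega> \<in> D"
      using good \<open>\<omega> \<in> space P\<close> by (simp add: D_def good_def)
  qed

  \<comment> \<open>\<open>a\<close> is the sign for \<open>f\<close> and \<open>b\<close> the sign
    for all other elements: \<open>a\<close> can move \<open>f\<close> into the second half,
    \<open>b\<close> can exchange the halves. Two choices for each give the constant
    \<open>1 / 4\<close>.\<close>
  define sg where "sg a b = (\<lambda>e. if e = f then a else b :: int)" for a b
  define Z where "Z = {\<omega> \<in> space P. L f \<omega> = 2}"
  have "Z \<in> events"
    using rvt[OF \<open>f \<in> S\<close>] unfolding Z_def L_def by measurable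
  have Z0: "prob Z = 0"
    using prob_label_minus(2)[OF pp rvt assms(11)] \<open>f \<in> S\<close> by (simp add: Z_def L_def)
  \<comment> \<open>Every outcome with \<open>f\<close> in the core becomes good under at least one
    of the four sign changes, unless \<open>f\<close> has the null label \<open>2\<close>.\<close>
  have C_sub: "C \<subseteq> (E (sg 1 1) \<union> E (sg 1 (-1))) \<union> (E (sg (-1) 1) \<union> E (sg (-1) (-1))) \<union> Z"
  proof
    fix \<omega> assume "\<omega> \<in> C"
    then have \<omega>: "\<omega> \<in> space P" "core (lab (\<lambda>_. 1) \<omega>)"
      by (auto simp: C_def)
    let ?R = "rel (lab (\<lambda>_. 1) \<omega>)"
    \<comment> \<open>Signs preserve the label \<open>0\<close>, hence the sample and the relevant
      elements.\<close>
    have sg_rel: "rel (lab (sg a b) \<omega>) = ?R" if "a \<in> {1, -1}" "b \<in> {1, -1}" for a b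
    proof -
      have "{e \<in> S. lab (sg a b) \<omega> e = 0} = {e \<in> S. lab (\<lambda>_. 1) \<omega> e = 0}"
        using that by (auto simp: lab_def sg_def)
      then show ?thesis
        by (simp add: rel_def)
    qed
    have "f \<in> ?R"
      using \<omega>(2) unfolding core_def by (rule subsetD[OF Core_subset[OF assms(1)]])
    \<comment> \<open>A relevant element is not in the sample, so outside \<open>Z\<close> its label
      is \<open>1\<close> or \<open>-1\<close>, and some \<open>a\<close> brings it to
      \<open>-1\<close>.\<close>
    then have "L f \<omega> \<noteq> 0"
      using \<open>f \<in> S\<close> unfolding rel_def Rel_def by (auto simp: lab_def)
    then consider "L f \<omega> = 2" | a where "a \<in> {1, -1}" "a * L f \<omega> = -1"
      using label_eq_iff(4)[OF pp, of "t f \<omega>"] unfolding L_def by force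
    then show "\<omega> \<in> (E (sg 1 1) \<union> E (sg 1 (-1))) \<union> (E (sg (-1) 1) \<union> E (sg (-1) (-1))) \<union> Z"
    proof cases
      case 1
      then show ?thesis
        using \<omega> by (simp add: Z_def)
    next
      case (2 a)
      \<comment> \<open>Without \<open>f\<close> these sets do not depend on \<open>a\<close>, and
        \<open>b = -1\<close> exchanges them.\<close>
      have halves: "?R \<inter> {e \<in> S. lab (sg a b) \<omega> e = c} - {f} = ?R \<inter> {e \<in> S. L e \<omega> = b * c} - {f}"
        if "b \<in> {1, -1}" for b c
        using that by (auto simp: lab_def sg_def)
      have "good (lab (sg a b) \<omega>) \<longleftrightarrow>
          (\<forall>x. f \<in> Hull N G F {g \<in> ?R \<inter> {e \<in> S. L e \<omega> = - b} - {f}. w g > x} \<longrightarrow>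
               f \<in> Hull N G F {g \<in> ?R \<inter> {e \<in> S. L e \<omega> = b} - {f}. w g > x})"
        if "b \<in> {1, -1}" for b
      proof -
        have "core (lab (sg a b) \<omega>)"
          using \<omega>(2) sg_rel[OF 2(1) that] by (simp add: core_def)
        moreover have "lab (sg a b) \<omega> f = -1"
          using 2(2) \<open>f \<in> S\<close> by (simp add: lab_def sg_def)
        ultimately show ?thesis
          unfolding good_def sg_rel[OF 2(1) that] halves[OF that] by simp
      qed
      from this[of 1] this[of "-1"]
      have "good (lab (sg a 1) \<omega>) \<or> good (lab (sg a (-1)) \<omega>)"
        using Hull_heavier_linear[of f N G F "?R \<inter> {e \<in> S. L e \<omega> = -1} - {f}" w
            "?R \<inter> {e \<in> S. L e \<omega> = 1} - {f}"] by simp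
      then show ?thesis
        using 2(1) \<omega>(1) by (auto simp: E_def)
    qed
  qed

  \<comment> \<open>The four events may overlap; a union bound suffices because they have equal
    probabilities.\<close>
  have "prob C \<le> prob ((E (sg 1 1) \<union> E (sg 1 (-1))) \<union> (E (sg (-1) 1) \<union> E (sg (-1) (-1))) \<union> Z)"
    using \<open>Z \<in> events\<close> by (intro finite_measure_mono C_sub) auto
  also have "\<dots> \<le> prob (E (sg 1 1)) + prob (E (sg 1 (-1))) + (prob (E (sg (-1) 1)) + prob (E (sg (-1) (-1)))) + prob Z"
    using \<open>Z \<in> events\<close>
    by (intro order_trans[OF measure_Un_le] add_mono order_refl) auto
  also have "\<dots> = 4 * prob (E (\<lambda>_. 1))"
  proof -
    have "prob (E (sg a b)) = prob (E (\<lambda>_. 1))" if "a \<in> {1, -1}" "b \<in> {1, -1}" for a b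
      by (rule prob_E) (use that in \<open>simp add: sg_def\<close>)
    then show ?thesis
      by (simp add: Z0)
  qed
  also have "\<dots> \<le> 4 * prob D"
    using E_sub by (intro mult_left_mono finite_measure_mono) auto
  finally have "1 / 4 * prob C \<le> prob D"
    by simp
  moreover have "prob C > 0"
    using pos by (simp add: C_def core_eq)
  ultimately show "\<P>(\<omega> in P. f \<in> ALG \<omega> \<bar> f \<in> Core N G F w (Rel S I w (sampleY S p (\<lambda>e. t e \<omega>)))) \<ge> 1 / 4"
    by (simp add: cond_prob_def C_def D_def core_eq pos_le_divide_eq)
qed

end
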